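(* For every positive integer $n$ we have $f_A(n)\ge 2n-9$.
   Context: A tree $T$ is hidden on a known vertex set $V$ with $|V|=n$. A distance query is an unordered pair $\{x,y\}$ of distinct vertices of $V$, and its answer is the distance $d_T(x,y)$ of $x$ and $y$ in $T$. In an adaptive algorithm each query may depend on the answers to the previous queries. A tree on $V$ is consistent with the answers received so far if its distance between every queried pair equals the answer. $f_A(n)$ is the smallest integer $k$ such that there is an adaptive algorithm which, for every hidden tree $T$ on $V$, after at most $k$ queries reaches a state in which there exist two vertices $x,y$ such that, in every tree consistent with the answers, the distance of $x$ and $y$ equals the maximum distance (diameter) of that tree. *)

theory Defs
  imports Main
begin

text \<open>
  A simple graph on a vertex set \<open>V\<close> is given by its set of edges, which are two-element
  subsets of \<open>V\<close>.  Walks are non-empty vertex lists; the list \<open>p\<close> has \<open>length p - 1\<close> edges.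
\<close>

definition walk :: "'a set \<Rightarrow> 'a set set \<Rightarrow> 'a list \<Rightarrow> bool" where
  "walk V E p \<longleftrightarrow> p \<noteq> [] \<and> set p \<subseteq> V \<and> (\<forall>i. Suc i < length p \<longrightarrow> {p ! i, p ! Suc i} \<in> E)"

definition walk_betw :: "'a set \<Rightarrow> 'a set set \<Rightarrow> 'a \<Rightarrow> 'a list \<Rightarrow> 'a \<Rightarrow> bool" where
  "walk_betw V E x p y \<longleftrightarrow> walk V E p \<and> hd p = x \<and> last p = y"

definition graph_cycle :: "'a set \<Rightarrow> 'a set set \<Rightarrow> 'a list \<Rightarrow> bool" where
  "graph_cycle V E p \<longleftrightarrow> walk V E p \<and> length p \<ge> 3 \<and> distinct p \<and> {last p, hd p} \<in> E"

definition tree_on :: "'a set \<Rightarrow> 'a set set \<Rightarrow> bool" where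
  "tree_on V E \<longleftrightarrow> V \<noteq> {} \<and> (\<forall>e\<in>E. e \<subseteq> V \<and> card e = 2) \<and>
     (\<forall>x\<in>V. \<forall>y\<in>V. \<exists>p. walk_betw V E x p y) \<and>
     (\<nexists>p. graph_cycle V E p)"

definition graph_dist :: "'a set \<Rightarrow> 'a set set \<Rightarrow> 'a \<Rightarrow> 'a \<Rightarrow> nat" where
  "graph_dist V E x y = (LEAST k. \<exists>p. walk_betw V E x p y \<and> length p = Suc k)"

definition graph_diameter :: "'a set \<Rightarrow> 'a set set \<Rightarrow> nat" where
  "graph_diameter V E = Max {graph_dist V E x y | x y. x \<in> V \<and> y \<in> V}"

definition queries :: "'a set \<Rightarrow> 'a set set" where
  "queries V = {{x, y} | x y. x \<in> V \<and> y \<in> V \<and> x \<noteq> y}"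

text \<open>The description below is unique for a query because the distance is symmetric.\<close>

definition answer :: "'a set \<Rightarrow> 'a set set \<Rightarrow> 'a set \<Rightarrow> nat" where
  "answer V E q = (THE d. \<exists>x y. q = {x, y} \<and> d = graph_dist V E x y)"

type_synonym 'a history = "('a set \<times> nat) list"

text \<open>
  An adaptive algorithm maps the queries and answers seen so far (oldest first) to the next
  query, or to \<open>None\<close> if it stops.
\<close>

type_synonym 'a algorithm = "'a history \<Rightarrow> 'a set option"

definition algorithm_on :: "'a set \<Rightarrow> 'a algorithm \<Rightarrow> bool" where
  "algorithm_on V A \<longleftrightarrow> (\<forall>h q. A h = Some q \<longrightarrow> q \<in> queries V)"

text \<open>\<open>run V A E k\<close> is the history once \<open>A\<close> has stopped or asked \<open>k\<close> queries about \<open>E\<close>.\<close>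

primrec run :: "'a set \<Rightarrow> 'a algorithm \<Rightarrow> 'a set set \<Rightarrow> nat \<Rightarrow> 'a history" where
  "run V A E 0 = []"
| "run V A E (Suc k) = (let h = run V A E k in
     case A h of None \<Rightarrow> h | Some q \<Rightarrow> h @ [(q, answer V E q)])"

definition consistent :: "'a set \<Rightarrow> 'a history \<Rightarrow> 'a set set \<Rightarrow> bool" where
  "consistent V h E \<longleftrightarrow> tree_on V E \<and> (\<forall>(q, a)\<in>set h. answer V E q = a)"

text \<open>
  The vertices \<open>x\<close> and \<open>y\<close> are automatically distinct unless \<open>V\<close> is a singleton.
\<close>

definition diameter_pair_known :: "'a set \<Rightarrow> 'a history \<Rightarrow> bool" where
  "diameter_pair_known V h \<longleftrightarrow>
     (\<exists>x\<in>V. \<exists>y\<in>V. \<forall>E. consistent V h E \<longrightarrow> graph_dist V E x y = graph_diameter V E)"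

definition adaptively_solvable :: "'a set \<Rightarrow> nat \<Rightarrow> bool" where
  "adaptively_solvable V k \<longleftrightarrow>
     (\<exists>A. algorithm_on V A \<and> (\<forall>E. tree_on V E \<longrightarrow> diameter_pair_known V (run V A E k)))"

text \<open>
  The number \<open>f_A V\<close> depends only on the cardinality of \<open>V\<close>.
\<close>

definition f_A :: "'a set \<Rightarrow> nat" where
  "f_A V = (LEAST k. adaptively_solvable V k)"

lemma graph_dist_commute: "graph_dist V E x y = graph_dist V E y x"
proof -
  have *: "walk_betw V E y (rev p) x" if "walk_betw V E x p y" for x y p
  proof -
    have "{rev p ! i, rev p ! Suc i} \<in> E" if i: "Suc i < length p" for i
    proof -
      let ?j = "length p - Suc (Suc i)"
      have "Suc ?j < length p" using i by simp
      then have "{p ! ?j, p ! Suc ?j} \<in> E"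
        using \<open>walk_betw V E x p y\<close> unfolding walk_betw_def walk_def by blast
      moreover have "rev p ! i = p ! Suc ?j" "rev p ! Suc i = p ! ?j"
        using i by (simp_all add: rev_nth Suc_diff_Suc)
      ultimately show ?thesis by (simp add: insert_commute)
    qed
    then show ?thesis using that
      by (auto simp: walk_betw_def walk_def hd_rev last_rev)
  qed
  have "(\<exists>p. walk_betw V E x p y \<and> length p = Suc k) \<longleftrightarrow>
        (\<exists>p. walk_betw V E y p x \<and> length p = Suc k)" for k
    using * by (metis length_rev)
  then show ?thesis unfolding graph_dist_def by simp
qed

lemma answer_eq: "answer V E {x, y} = graph_dist V E x y"
  unfolding answer_def
  by (rule the_equality) (auto simp: doubleton_eq_iff graph_dist_commute)

text \<open>The minimum defining \<open>f_A\<close> is attained: asking all pairs solves the problem.\<close>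

lemma adaptively_solvable_ex:
  assumes "finite V"
  shows "\<exists>k. adaptively_solvable V k"
proof -
  have "queries V \<subseteq> Pow V" by (auto simp: queries_def)
  then have "finite (queries V)" using assms finite_subset by blast
  then obtain qs where qs: "set qs = queries V" using finite_list by blast
  define A :: "'a algorithm" where
    "A h = (if length h < length qs then Some (qs ! length h) else None)" for h
  have "algorithm_on V A"
    using qs nth_mem by (fastforce simp: algorithm_on_def A_def split: if_splits)
  moreover have "diameter_pair_known V (run V A E (length qs))" if T: "tree_on V E" for E
  proof -
    have "k \<le> length qs \<Longrightarrow> run V A E k = map (\<lambda>q. (q, answer V E q)) (take k qs)" for k
      by (induction k) (auto simp: A_def Let_def take_Suc_conv_app_nth)
    then have run: "run V A E (length qs) = map (\<lambda>q. (q, answer V E q)) qs" by simp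
    let ?D = "{graph_dist V E x y | x y. x \<in> V \<and> y \<in> V}"
    have "?D = (\<lambda>(x, y). graph_dist V E x y) ` (V \<times> V)" by auto
    then have "finite ?D" using assms by simp
    moreover have "?D \<noteq> {}" using T unfolding tree_on_def by blast
    ultimately have "Max ?D \<in> ?D" by (rule Max_in)
    then obtain x y where xy: "x \<in> V" "y \<in> V" "graph_dist V E x y = graph_diameter V E"
      unfolding graph_diameter_def by auto
    have "graph_dist V F x y = graph_diameter V F"
      if F: "consistent V (run V A E (length qs)) F" for F
    proof -
      have refl0: "graph_dist V G u u = 0" if "u \<in> V" for G u
        unfolding graph_dist_def
        by (rule Least_equality)
           (use that in \<open>auto intro!: exI[of _ "[u]"] simp: walk_betw_def walk_def\<close>)
      have same: "graph_dist V F u v = graph_dist V E u v" if "u \<in> V" "v \<in> V" for u v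
      proof (cases "u = v")
        case True
        then show ?thesis using refl0 that by simp
      next
        case False
        then have "{u, v} \<in> set qs" using that qs by (auto simp: queries_def)
        then have "answer V F {u, v} = answer V E {u, v}"
          using F unfolding consistent_def run by auto
        then show ?thesis by (simp add: answer_eq)
      qed
      have "{graph_dist V F u v | u v. u \<in> V \<and> v \<in> V} = ?D"
        using same by (metis (no_types, opaque_lifting))
      then show ?thesis using xy same by (simp add: graph_diameter_def)
    qed
    then show ?thesis using xy by (auto simp: diameter_pair_known_def)
  qed
  ultimately show ?thesis unfolding adaptively_solvable_def by blast
qed

end

theory Submission
  imports Defs "HOL-Library.Disjoint_Sets"
begin

text \<open>
  The adversary answers as if the hidden tree were a double star with fixed adjacent centres \<open>a\<close> and
  \<open>b\<close>, the other vertices being coloured by the centre from which they hang.  A query that joins two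
  components of the query graph is answered as if the two vertices had different colours; this goes
  on until two components are left, which takes \<open>n - 4\<close> queries if \<open>a\<close>, \<open>b\<close> and one more vertex are
  joined for free.  Then the colouring is fixed so that different colours have the majority in the
  two components.

  If a set \<open>S\<close> of leaves of \<open>b\<close> has no query to other vertices of its colour and misses some leaf \<open>u\<close> of
  \<open>a\<close>, then \<open>S\<close> may be moved from \<open>b\<close> to \<open>u\<close>, which increases the diameter.  So the monochromatic
  queries must almost connect each colour class, which takes \<open>n - O(1)\<close> queries disjoint from the
  first ones, or else there are many blocks all of which dominate the opposite class; by the choice
  of the colouring these need about as many additional queries as they save.
\<close>

section \<open>Trees of depth two\<close>

lemma walk_singleton [simp]: "walk V E [x] \<longleftrightarrow> x \<in> V"
  by (auto simp: walk_def)

lemma walk_Cons_Cons [simp]: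
  "walk V E (x # y # p) \<longleftrightarrow> x \<in> V \<and> {x, y} \<in> E \<and> walk V E (y # p)"
proof -
  have all_nat: "(\<forall>i. P i) \<longleftrightarrow> P 0 \<and> (\<forall>i. P (Suc i))" for P :: "nat \<Rightarrow> bool"
    by (metis not0_implies_Suc)
  have "(\<forall>i. Suc i < length (x # y # p) \<longrightarrow> {(x # y # p) ! i, (x # y # p) ! Suc i} \<in> E) \<longleftrightarrow>
    {x, y} \<in> E \<and> (\<forall>i. Suc i < length (y # p) \<longrightarrow> {(y # p) ! i, (y # p) ! Suc i} \<in> E)"
    by (subst all_nat) auto
  then show ?thesis by (auto simp: walk_def)
qed

text \<open>A potential that rises by at most one per edge bounds walk lengths from below. The
  additive form avoids subtraction, since a list \<open>p\<close> has \<open>length p - 1\<close>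
  edges.\<close>

lemma walk_lipschitz:
  fixes f :: "'a \<Rightarrow> nat"
  assumes "walk V E p" and "\<And>u v. {u, v} \<in> E \<Longrightarrow> f v \<le> f u + 1"
  shows "f (last p) + 1 \<le> f (hd p) + length p"
  using assms(1)
proof (induction p rule: induct_list012)
  case (3 x y p)
  then show ?case using assms(2)[of x y] by auto
qed (auto simp: walk_def)

text \<open>Both the double star and the tree obtained from it by moving leaves are rooted trees of
  depth at most two, so one distance computation serves both.\<close>

locale depth_two_tree =
  fixes V :: "'a set" and r :: 'a and parent :: "'a \<Rightarrow> 'a"
  assumes root: "r \<in> V"
    and parent: "v \<in> V \<Longrightarrow> v \<noteq> r \<Longrightarrow> parent v = r \<or> parent v \<in> V \<and> parent v \<noteq> r \<and> parent (parent v) = r"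
begin

definition edges :: "'a set set" where
  "edges = (\<lambda>v. {v, parent v}) ` (V - {r})"

definition depth :: "'a \<Rightarrow> nat" where
  "depth v = (if v = r then 0 else if parent v = r then 1 else 2)"

definition branch :: "'a \<Rightarrow> 'a" where
  "branch v = (if parent v = r then v else parent v)"

text \<open>Two vertices of one branch meet at depth one, which saves the two edges to the root;
  this covers siblings as well as parent and child. The root lies in no branch and is treated
  apart.\<close>

definition tree_dist :: "'a \<Rightarrow> 'a \<Rightarrow> nat" where
  "tree_dist x y = (if x = y then 0 else if x = r \<or> y = r then depth x + depth y
     else if branch x = branch y then depth x + depth y - 2 else depth x + depth y)"

lemma parent_in: "v \<in> V \<Longrightarrow> v \<noteq> r \<Longrightarrow> parent v \<in> V"
  using parent root by auto

lemma parent_neq: "v \<in> V \<Longrightarrow> v \<noteq> r \<Longrightarrow> parent v \<noteq> v"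
  using parent by metis

lemma depth_parent: "v \<in> V \<Longrightarrow> v \<noteq> r \<Longrightarrow> depth v = Suc (depth (parent v))"
  using parent[of v] by (auto simp: depth_def)

lemma edgeI: "v \<in> V \<Longrightarrow> v \<noteq> r \<Longrightarrow> {v, parent v} \<in> edges"
  and edgeI': "v \<in> V \<Longrightarrow> v \<noteq> r \<Longrightarrow> {parent v, v} \<in> edges"
  by (auto simp: edges_def insert_commute)

lemma edgeE:
  assumes "{u, v} \<in> edges"
  obtains "u \<in> V" "u \<noteq> r" "v = parent u" | "v \<in> V" "v \<noteq> r" "u = parent v"
  using assms by (fastforce simp: edges_def doubleton_eq_iff)

lemma tree_dist_lipschitz:
  assumes "x \<in> V" "{u, v} \<in> edges"
  shows "tree_dist x v \<le> tree_dist x u + 1"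
  using assms(2)
proof (cases rule: edgeE)
  case 1
  then show ?thesis using parent[of u] parent[of x] assms(1) parent_neq[of u] parent_neq[of x]
    by (auto simp: tree_dist_def depth_def branch_def)
next
  case 2
  then show ?thesis using parent[of v] parent[of x] assms(1) parent_neq[of v] parent_neq[of x]
    by (auto simp: tree_dist_def depth_def branch_def)
qed

lemma tree_dist_le: "tree_dist x y \<le> depth x + depth y"
  by (simp add: tree_dist_def)

lemma depth_le: "depth v \<le> 2"
  by (simp add: depth_def)

lemma ex_walk:
  assumes "x \<in> V" "y \<in> V"
  shows "\<exists>p. walk_betw V edges x p y \<and> length p = Suc (tree_dist x y)"
proof -
  have root_edge: "{v, r} \<in> edges" "{r, v} \<in> edges" if "v \<in> V" "v \<noteq> r" "parent v = r" for v
    using edgeI[of v] edgeI'[of v] that by auto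
  have par: "parent v \<in> V" "parent v \<noteq> r" "parent (parent v) = r" "{v, parent v} \<in> edges"
    "{parent v, v} \<in> edges" "{parent v, r} \<in> edges" "{r, parent v} \<in> edges"
    if "v \<in> V" "v \<noteq> r" "parent v \<noteq> r" for v
    using parent[of v] that edgeI[of v] edgeI'[of v] root_edge[of "parent v"] by auto
  \<comment> \<open>The cases record depths and the place where the two paths to the root meet; each
    has an explicit walk.\<close>
  consider "x = y" | "x = r" "y \<noteq> r" "parent y = r" | "x = r" "y \<noteq> r" "parent y \<noteq> r"
    | "y = r" "x \<noteq> r" "parent x = r" | "y = r" "x \<noteq> r" "parent x \<noteq> r"
    | "x \<noteq> y" "x \<noteq> r" "y \<noteq> r" "parent x = r" "parent y = r"
    | "x \<noteq> r" "y \<noteq> r" "parent x = r" "parent y \<noteq> r" "x = parent y"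
    | "x \<noteq> r" "y \<noteq> r" "parent x = r" "parent y \<noteq> r" "x \<noteq> parent y"
    | "x \<noteq> r" "y \<noteq> r" "parent x \<noteq> r" "parent y = r" "y = parent x"
    | "x \<noteq> r" "y \<noteq> r" "parent x \<noteq> r" "parent y = r" "y \<noteq> parent x"
    | "x \<noteq> y" "x \<noteq> r" "y \<noteq> r" "parent x \<noteq> r" "parent y \<noteq> r" "parent x = parent y"
    | "x \<noteq> y" "x \<noteq> r" "y \<noteq> r" "parent x \<noteq> r" "parent y \<noteq> r" "parent x \<noteq> parent y"
    by metis
  then show ?thesis
  proof cases
    case 1
    then show ?thesis using assms
      by (intro exI[of _ "[x]"]) (simp add: walk_betw_def tree_dist_def)
  next
    case 2
    then show ?thesis using assms root_edge[of y]
      by (intro exI[of _ "[r, y]"]) (simp add: walk_betw_def tree_dist_def depth_def)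
  next
    case 3
    then show ?thesis using assms par[of y]
      by (intro exI[of _ "[r, parent y, y]"]) (simp add: walk_betw_def tree_dist_def depth_def)
  next
    case 4
    then show ?thesis using assms root_edge[of x]
      by (intro exI[of _ "[x, r]"]) (simp add: walk_betw_def tree_dist_def depth_def)
  next
    case 5
    then show ?thesis using assms par[of x]
      by (intro exI[of _ "[x, parent x, r]"]) (simp add: walk_betw_def tree_dist_def depth_def)
  next
    case 6
    then show ?thesis using assms root root_edge[of x] root_edge[of y]
      by (intro exI[of _ "[x, r, y]"]) (simp add: walk_betw_def tree_dist_def depth_def branch_def)
  next
    case 7
    then show ?thesis using assms par[of y] parent_neq[of y]
      by (intro exI[of _ "[x, y]"]) (auto simp: walk_betw_def tree_dist_def depth_def branch_def)
  next
    case 8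
    then show ?thesis using assms root par[of y] root_edge[of x]
      by (intro exI[of _ "[x, r, parent y, y]"])
        (auto simp: walk_betw_def tree_dist_def depth_def branch_def)
  next
    case 9
    then show ?thesis using assms par[of x] parent_neq[of x]
      by (intro exI[of _ "[x, y]"]) (auto simp: walk_betw_def tree_dist_def depth_def branch_def)
  next
    case 10
    then show ?thesis using assms root par[of x] root_edge[of y]
      by (intro exI[of _ "[x, parent x, r, y]"])
        (auto simp: walk_betw_def tree_dist_def depth_def branch_def)
  next
    case 11
    then show ?thesis using assms par[of x] par[of y]
      by (intro exI[of _ "[x, parent x, y]"])
        (auto simp: walk_betw_def tree_dist_def depth_def branch_def)
  next
    case 12
    then show ?thesis using assms root par[of x] par[of y]
      by (intro exI[of _ "[x, parent x, r, parent y, y]"])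
        (auto simp: walk_betw_def tree_dist_def depth_def branch_def)
  qed
qed

text \<open>The explicit walk bounds the distance from above; \<open>tree_dist x\<close>, which is
  Lipschitz along edges, bounds it from below.\<close>

lemma graph_dist_edges:
  assumes "x \<in> V" "y \<in> V"
  shows "graph_dist V edges x y = tree_dist x y"
  unfolding graph_dist_def
proof (rule Least_equality)
  show "\<exists>p. walk_betw V edges x p y \<and> length p = Suc (tree_dist x y)"
    using ex_walk[OF assms] .
next
  fix k assume "\<exists>p. walk_betw V edges x p y \<and> length p = Suc k"
  then obtain p where p: "walk V edges p" "hd p = x" "last p = y" "length p = Suc k"
    by (auto simp: walk_betw_def)
  have "tree_dist x (last p) + 1 \<le> tree_dist x (hd p) + length p"
    using p(1) by (rule walk_lipschitz) (rule tree_dist_lipschitz[OF assms(1)])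
  then show "tree_dist x y \<le> k" using p by (simp add: tree_dist_def)
qed

text \<open>Both neighbours of a deepest vertex of a cycle would have to be its parent.\<close>

lemma no_cycle: "\<not> graph_cycle V edges p"
proof
  assume "graph_cycle V edges p"
  then have w: "walk V edges p" and len: "length p \<ge> 3" and dist: "distinct p"
    and closing: "{last p, hd p} \<in> edges"
    by (auto simp: graph_cycle_def)
  let ?n = "length p"
  have adj: "{p ! i, p ! (Suc i mod ?n)} \<in> edges" if "i < ?n" for i
  proof (cases "Suc i < ?n")
    case True
    then show ?thesis using w by (simp add: walk_def)
  next
    case False
    then have "i = ?n - 1" using that by simp
    then show ?thesis using closing len by (cases "p = []") (auto simp: last_conv_nth hd_conv_nth)
  qed
  define m where "m = Max ((\<lambda>i. depth (p ! i)) ` {..<?n})"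
  have "m \<in> (\<lambda>i. depth (p ! i)) ` {..<?n}"
    unfolding m_def using len by (intro Max_in) (auto simp: lessThan_empty_iff)
  then obtain i where i: "i < ?n" "depth (p ! i) = m" by auto
  have "depth (p ! j) \<le> m" if "j < ?n" for j
    using that unfolding m_def by (intro Max_ge) auto
  then have max: "depth (p ! j) \<le> depth (p ! i)" if "j < ?n" for j
    using that i by simp
  have up: "p ! j = parent (p ! i)" if "j < ?n" "{p ! i, p ! j} \<in> edges" for j
    using that(2)
  proof (cases rule: edgeE)
    case 2
    then show ?thesis using depth_parent[of "p ! j"] max[OF that(1)] by simp
  qed
  define j where "j = (if i = 0 then ?n - 1 else i - 1)"
  have j: "j < ?n" "Suc j mod ?n = i" using i len by (auto simp: j_def)
  have "p ! j = parent (p ! i)"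
    using adj[OF j(1)] j by (intro up) (auto simp: insert_commute)
  moreover have "Suc i mod ?n < ?n" using len by (intro mod_less_divisor) linarith
  moreover then have "p ! (Suc i mod ?n) = parent (p ! i)" by (intro up adj i)
  \<comment> \<open>The cyclic predecessor and successor of the deepest vertex coincide, which is
    impossible on at least three distinct vertices.\<close>
  ultimately have "j = Suc i mod ?n" using dist j by (metis nth_eq_iff_index_eq)
  then show False using i len by (cases "Suc i = ?n") (auto simp: j_def split: if_splits)
qed

lemma tree_on_edges: "tree_on V edges"
  unfolding tree_on_def
proof (intro conjI ballI)
  show "V \<noteq> {}" using root by auto
  show "\<nexists>p. graph_cycle V edges p" using no_cycle by blast
  show "\<exists>p. walk_betw V edges x p y" if "x \<in> V" "y \<in> V" for x y
    using ex_walk[OF that] by blast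
  fix e assume "e \<in> edges"
  then obtain v where "e = {v, parent v}" "v \<in> V" "v \<noteq> r" by (auto simp: edges_def)
  then show "e \<subseteq> V" "card e = 2" using parent_in[of v] parent_neq[of v] by auto
qed

end


section \<open>Double stars\<close>

text \<open>
  The colour \<open>\<sigma> v\<close> of a vertex decides whether it hangs from \<open>b\<close> or from \<open>a\<close>.  Distances depend on the
  colouring only through the question whether the two vertices have the same colour.
\<close>

definition hub :: "'a \<Rightarrow> 'a \<Rightarrow> ('a \<Rightarrow> bool) \<Rightarrow> 'a \<Rightarrow> 'a" where
  "hub a b \<sigma> v = (if \<sigma> v \<and> v \<noteq> b then b else a)"

definition double_star :: "'a set \<Rightarrow> 'a \<Rightarrow> 'a \<Rightarrow> ('a \<Rightarrow> bool) \<Rightarrow> 'a set set" where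
  "double_star V a b \<sigma> = (\<lambda>v. {v, hub a b \<sigma> v}) ` (V - {a})"

locale coloured_hubs =
  fixes V :: "'a set" and a b :: 'a and \<sigma> :: "'a \<Rightarrow> bool"
  assumes a: "a \<in> V" "\<not> \<sigma> a" and b: "b \<in> V" "\<sigma> b"
begin

sublocale depth_two_tree V a "hub a b \<sigma>"
  using a b by unfold_locales (auto simp: hub_def)

lemma edges_eq: "edges = double_star V a b \<sigma>"
  by (simp add: edges_def double_star_def)

lemma tree_on_double_star: "tree_on V (double_star V a b \<sigma>)"
  using tree_on_edges by (simp add: edges_eq)

text \<open>Leaves of one colour meet at their common centre. A path between different colours uses
  the edge joining the centres and one more edge per endpoint that is a leaf.\<close>

lemma graph_dist_double_star:
  assumes "x \<in> V" "y \<in> V" "x \<noteq> y"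
  shows "graph_dist V (double_star V a b \<sigma>) x y =
    (if \<sigma> x = \<sigma> y then if x \<in> {a, b} \<or> y \<in> {a, b} then 1 else 2
     else 1 + of_bool (x \<notin> {a, b}) + of_bool (y \<notin> {a, b}))"
proof -
  have depth: "depth v = (if v = a then 0 else if \<sigma> v \<and> v \<noteq> b then 2 else 1)" for v
    using a b by (auto simp: depth_def hub_def)
  have branch: "branch v = (if \<sigma> v then b else v)" if "v \<noteq> a" for v
    using a b that by (auto simp: branch_def hub_def)
  have "graph_dist V (double_star V a b \<sigma>) x y = tree_dist x y"
    using graph_dist_edges[OF assms(1,2)] by (simp add: edges_eq)
  then show ?thesis
    using assms(3) a b by (cases "\<sigma> x"; cases "\<sigma> y") (auto simp: tree_dist_def depth branch)
qed

text \<open>The definition roots the tree at \<open>a\<close>, so the symmetry of the centres needs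
  a proof. It transfers arguments about leaves of \<open>b\<close> to leaves of
  \<open>a\<close>.\<close>

lemma double_star_swap: "double_star V b a (\<lambda>v. \<not> \<sigma> v) = double_star V a b \<sigma>"
proof -
  have V: "V - {a} = insert b (V - {a, b})" "V - {b} = insert a (V - {a, b})"
    using a b by auto
  have "hub b a (\<lambda>v. \<not> \<sigma> v) v = hub a b \<sigma> v" if "v \<in> V - {a, b}" for v
    using that by (auto simp: hub_def)
  then have "(\<lambda>v. {v, hub b a (\<lambda>v. \<not> \<sigma> v) v}) ` (V - {a, b}) =
      (\<lambda>v. {v, hub a b \<sigma> v}) ` (V - {a, b})"
    by (intro image_cong) auto
  then show ?thesis
    using a b unfolding double_star_def V image_insert
    by (simp add: hub_def insert_commute)
qed

end

section \<open>Moving leaves without changing queried distances\<close>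

lemma graph_dist_le_diameter:
  assumes "finite V" "x \<in> V" "y \<in> V"
  shows "graph_dist V E x y \<le> graph_diameter V E"
proof -
  have "{graph_dist V E x y | x y. x \<in> V \<and> y \<in> V} = (\<lambda>(x, y). graph_dist V E x y) ` (V \<times> V)"
    by auto
  then have "finite {graph_dist V E x y | x y. x \<in> V \<and> y \<in> V}" using assms(1) by simp
  then show ?thesis unfolding graph_diameter_def using assms by (intro Max_ge) auto
qed

text \<open>
  Moving the leaves in \<open>S\<close> from \<open>b\<close> to \<open>u\<close> raises the diameter from 3 to 4 without changing any
  queried distance, and no pair is diametral in both trees.
\<close>

lemma (in coloured_hubs) diameter_pair_unknown_if_movable:
  assumes fin: "finite V"
    and S: "S \<subseteq> V" "\<And>s. s \<in> S \<Longrightarrow> \<sigma> s \<and> s \<noteq> b" "S \<noteq> {}"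
    and w: "w \<in> V" "\<sigma> w" "w \<noteq> b" "w \<notin> S"
    and u: "u \<in> V" "\<not> \<sigma> u" "u \<noteq> a"
    and g: "\<And>q d. (q, d) \<in> set g \<Longrightarrow> q \<in> queries V \<and> answer V (double_star V a b \<sigma>) q = d"
    and closed: "\<And>s t d. s \<in> S \<Longrightarrow> \<sigma> t \<Longrightarrow> t \<notin> S \<Longrightarrow> ({s, t}, d) \<notin> set g"
    and untouched: "\<And>s d. s \<in> S \<Longrightarrow> ({s, u}, d) \<notin> set g"
  shows "\<not> diameter_pair_known V g"
proof
  define par where "par v = (if v \<in> S then u else hub a b \<sigma> v)" for v
  interpret moved: depth_two_tree V a par
    using a b S u by unfold_locales (auto simp: par_def hub_def)
  have S': "a \<notin> S" "b \<notin> S" "u \<notin> S" using S a b u by auto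
  have par_S: "par v = u" "par v \<noteq> a" if "v \<in> S" for v using that u by (auto simp: par_def)
  have par_not_S: "par v = hub a b \<sigma> v" if "v \<notin> S" for v using that by (simp add: par_def)
  note moved_dist = moved.tree_dist_def moved.depth_def moved.branch_def
  \<comment> \<open>A moved leaf keeps its depth, so its distances can change only towards its old
    branch at \<open>b\<close> and its new branch at \<open>u\<close>.\<close>
  have leave: "graph_dist V moved.edges x y = graph_dist V (double_star V a b \<sigma>) x y"
    if "x \<in> V" "y \<in> V" "x \<in> S" "y \<notin> S" "\<not> \<sigma> y" "y \<noteq> u" for x y
  proof -
    have "x \<noteq> y" "x \<noteq> a" "x \<noteq> b" "\<sigma> x" "y \<noteq> b" "hub a b \<sigma> y = a"
      using that S(2)[of x] S' b by (auto simp: hub_def)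
    then show ?thesis
      using that par_S[of x] par_not_S[of y]
      by (simp add: moved.graph_dist_edges graph_dist_double_star moved_dist)
  qed
  have same: "graph_dist V moved.edges x y = graph_dist V (double_star V a b \<sigma>) x y"
    if "x \<in> V" "y \<in> V" "x \<noteq> y" "x \<in> S \<Longrightarrow> y \<notin> S \<Longrightarrow> \<not> \<sigma> y \<and> y \<noteq> u"
      "y \<in> S \<Longrightarrow> x \<notin> S \<Longrightarrow> \<not> \<sigma> x \<and> x \<noteq> u" for x y
  proof -
    consider "x \<in> S" "y \<in> S" | "x \<in> S" "y \<notin> S" | "x \<notin> S" "y \<in> S" | "x \<notin> S" "y \<notin> S"
      by blast
    then show ?thesis
    proof cases
      case 1
      then have "x \<noteq> a" "x \<noteq> b" "y \<noteq> a" "y \<noteq> b" "\<sigma> x" "\<sigma> y"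
        using S(2)[of x] S(2)[of y] S' by auto
      then show ?thesis
        using that(1-3) 1 par_S[of x] par_S[of y]
        by (simp add: moved.graph_dist_edges graph_dist_double_star moved_dist)
    next
      case 2
      then show ?thesis using leave[of x y] that by blast
    next
      case 3
      then show ?thesis using leave[of y x] that by (metis graph_dist_commute)
    next
      case 4
      then have "moved.depth v = depth v" "moved.branch v = branch v" if "v \<in> {x, y}" for v
        using par_not_S[of v] that
        by (auto simp: moved.depth_def moved.branch_def depth_def branch_def)
      then have "moved.tree_dist x y = tree_dist x y"
        by (simp add: moved.tree_dist_def tree_dist_def)
      then show ?thesis
        using that by (simp add: moved.graph_dist_edges graph_dist_edges flip: edges_eq)
    qed
  qed
  have "answer V moved.edges q = d" if qd: "(q, d) \<in> set g" for q d
  proof -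
    obtain x y where q: "q = {x, y}" "x \<in> V" "y \<in> V" "x \<noteq> y"
      using g[OF qd] by (auto simp: queries_def)
    have "graph_dist V moved.edges x y = graph_dist V (double_star V a b \<sigma>) x y"
      using qd q closed[of x y d] closed[of y x d] untouched[of x d] untouched[of y d]
      by (intro same) (auto simp: insert_commute)
    then show ?thesis using g[OF qd] by (simp add: q answer_eq)
  qed
  then have "consistent V g moved.edges"
    using moved.tree_on_edges by (auto simp: consistent_def)
  moreover have "consistent V g (double_star V a b \<sigma>)"
    using g tree_on_double_star by (auto simp: consistent_def)
  moreover assume "diameter_pair_known V g"
  ultimately obtain x y where xy: "x \<in> V" "y \<in> V"
    and dia: "graph_dist V (double_star V a b \<sigma>) x y = graph_diameter V (double_star V a b \<sigma>)"
    and dia': "graph_dist V moved.edges x y = graph_diameter V moved.edges"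
    unfolding diameter_pair_known_def by blast
  \<comment> \<open>The leaf \<open>w\<close> that stays at \<open>b\<close> witnesses diameter at
    least 3 before the move and at least 4 after it.\<close>
  have "graph_dist V (double_star V a b \<sigma>) u w = 3"
    using u w a b by (subst graph_dist_double_star) auto
  then have three: "graph_dist V (double_star V a b \<sigma>) x y \<ge> 3"
    using graph_dist_le_diameter[OF fin u(1) w(1)] dia by metis
  obtain s where s: "s \<in> S" using S by auto
  then have "graph_dist V moved.edges s w = 4"
    using w u S(1) S' a b par_S[OF s] par_not_S[OF w(4)]
    by (subst moved.graph_dist_edges) (auto simp: moved_dist hub_def)
  then have four: "moved.tree_dist x y \<ge> 4"
    using graph_dist_le_diameter[OF fin _ w(1), of s] dia' s S
    by (metis moved.graph_dist_edges subsetD xy)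
  have "x \<noteq> y" using four by (auto simp: moved.tree_dist_def)
  \<comment> \<open>A pair at distance 3 in the double star has an endpoint among the leaves of
    \<open>a\<close>. That endpoint still has depth one after the move, so the pair is then at
    distance at most 3.\<close>
  have "\<sigma> x \<noteq> \<sigma> y" "x \<notin> {a, b}" "y \<notin> {a, b}"
    using three graph_dist_double_star[OF xy \<open>x \<noteq> y\<close>]
    by (auto simp: of_bool_def split: if_splits)
  moreover have "moved.depth v = 1" if "\<not> \<sigma> v" "v \<noteq> a" for v
    using that par_not_S[of v] S(2)[of v] by (auto simp: moved.depth_def hub_def)
  ultimately have "moved.depth x = 1 \<or> moved.depth y = 1" by auto
  then have "moved.tree_dist x y \<le> 3"
    using moved.tree_dist_le[of x y] moved.depth_le[of x] moved.depth_le[of y] by linarith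
  then show False using four by simp
qed

section \<open>Runs of an algorithm\<close>

lemma run_entries:
  assumes "algorithm_on V A" "(q, d) \<in> set (run V A E k)"
  shows "q \<in> queries V \<and> answer V E q = d"
  using assms(2)
  by (induction k) (use assms(1) in \<open>auto simp: Let_def algorithm_on_def split: option.splits\<close>)

lemma length_run: "length (run V A E k) \<le> k"
  by (induction k) (auto simp: Let_def split: option.splits)

lemma run_extends: "j \<le> k \<Longrightarrow> \<exists>g. run V A E k = run V A E j @ g"
  by (induction k rule: dec_induct) (auto simp: Let_def split: option.splits)

lemma run_stopped: "j \<le> k \<Longrightarrow> A (run V A E j) = None \<Longrightarrow> run V A E k = run V A E j"
  by (induction k rule: dec_induct) auto

text \<open>Only the queries are tied to \<open>A\<close>; no tree is fixed, so the adversary may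
  choose one later.\<close>

definition history_of :: "'a algorithm \<Rightarrow> 'a history \<Rightarrow> bool" where
  "history_of A h \<longleftrightarrow> (\<forall>i < length h. A (take i h) = Some (fst (h ! i)))"

text \<open>The algorithm is deterministic, so a tree chosen afterwards that agrees with the
  recorded answers leads it through the same queries.\<close>

lemma run_eq_history:
  assumes "history_of A h" "\<And>q d. (q, d) \<in> set h \<Longrightarrow> answer V E q = d"
  shows "run V A E (length h) = h"
proof -
  have "run V A E i = take i h" if "i \<le> length h" for i
    using that
  proof (induction i)
    case (Suc i)
    then have "h ! i \<in> set h" by simp
    then have "answer V E (fst (h ! i)) = snd (h ! i)" using assms(2) by (metis prod.collapse)
    then show ?case using Suc assms(1)
      by (auto simp: history_of_def take_Suc_conv_app_nth)
  qed simp
  then show ?thesis by simp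
qed


section \<open>Partitions and counting\<close>

lemma partition_on_merge:
  assumes "partition_on V P" "C \<in> P" "D \<in> P"
  shows "partition_on V (insert (C \<union> D) (P - {C, D}))"
proof (rule partition_onI)
  show "\<Union> (insert (C \<union> D) (P - {C, D})) = V"
    using partition_onD1[OF assms(1)] assms(2,3) by auto
  show "{} \<notin> insert (C \<union> D) (P - {C, D})"
    using partition_onD3[OF assms(1)] assms(2,3) by auto
  have disj: "disjnt p q" if "p \<in> P" "q \<in> P" "p \<noteq> q" for p q
    using partition_onD2[OF assms(1)] that by (auto simp: disjoint_def disjnt_def)
  have merged: "disjnt (C \<union> D) q" if "q \<in> P - {C, D}" for q
    using that disj[OF assms(2)] disj[OF assms(3)] by (auto simp: disjnt_Un1)
  show "disjnt p q" if "p \<in> insert (C \<union> D) (P - {C, D})" "q \<in> insert (C \<union> D) (P - {C, D})"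
    "p \<noteq> q" for p q
    using that disj merged by (metis DiffD1 disjnt_sym insertE)
qed

lemma card_partition_merge:
  assumes "partition_on V P" "finite P" "C \<in> P" "D \<in> P" "C \<noteq> D"
  shows "card (insert (C \<union> D) (P - {C, D})) = card P - 1" "card P \<ge> 2"
proof -
  have "C \<union> D \<notin> P - {C, D}"
  proof
    assume *: "C \<union> D \<in> P - {C, D}"
    then have "C \<inter> (C \<union> D) = {}"
      using disjointD[OF partition_onD2[OF assms(1)] assms(3), of "C \<union> D"] by blast
    then show False using partition_onD3[OF assms(1)] assms(3) by auto
  qed
  moreover have two: "card {C, D} \<le> card P" using assms by (intro card_mono) auto
  then show "card P \<ge> 2" using assms(5) by simp
  ultimately show "card (insert (C \<union> D) (P - {C, D})) = card P - 1"
    using assms two by (simp add: card_Diff_subset)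
qed

text \<open>The blocks play the role of the connected components of the graph with edge set
  \<open>E\<close>: starting from singletons, each edge merges at most two blocks.\<close>

lemma ex_closed_partition:
  assumes "finite E" "finite Y" "\<And>e. e \<in> E \<Longrightarrow> \<exists>p q. e = {p, q} \<and> p \<in> Y \<and> q \<in> Y"
  shows "\<exists>P. partition_on Y P \<and> (\<forall>e\<in>E. \<exists>S\<in>P. e \<subseteq> S) \<and> card Y \<le> card E + card P"
  using assms(1,3)
proof (induction E rule: finite_induct)
  case empty
  have "partition_on Y ((\<lambda>y. {y}) ` Y)"
    by (auto simp: partition_on_def disjoint_def)
  moreover have "card ((\<lambda>y. {y}) ` Y) = card Y" by (simp add: card_image)
  ultimately show ?case by (intro exI[of _ "(\<lambda>y. {y}) ` Y"]) auto
next
  case (insert e E)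
  then obtain P where P: "partition_on Y P" "\<forall>e\<in>E. \<exists>S\<in>P. e \<subseteq> S" "card Y \<le> card E + card P"
    by blast
  obtain p q where e: "e = {p, q}" "p \<in> Y" "q \<in> Y" using insert.prems by blast
  obtain C D where CD: "C \<in> P" "p \<in> C" "D \<in> P" "q \<in> D"
    using e partition_onD1[OF P(1)] by auto
  have fin: "finite P" using P(1) assms(2) finite_elements by blast
  show ?case
  proof (cases "C = D")
    case True
    then have "\<forall>e\<in>insert e E. \<exists>S\<in>P. e \<subseteq> S" using P(2) CD e by auto
    then show ?thesis using P insert.hyps by (intro exI[of _ P]) auto
  next
    case False
    let ?P = "insert (C \<union> D) (P - {C, D})"
    have "\<exists>S\<in>?P. f \<subseteq> S" if f: "f \<in> insert e E" for f
    proof (cases "f = e")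
      case False
      then obtain S where "S \<in> P" "f \<subseteq> S" using P(2) f by blast
      then show ?thesis by (cases "S \<in> {C, D}") auto
    qed (use CD e in auto)
    moreover have "partition_on Y ?P" using partition_on_merge[OF P(1)] CD by blast
    moreover have "card Y \<le> card (insert e E) + card ?P"
      using card_partition_merge[OF P(1) fin CD(1,3) False] P(3) insert.hyps by simp
    ultimately show ?thesis by blast
  qed
qed

text \<open>Choose one pair of \<open>R\<close> for each vertex and block; disjointness of the
  blocks makes the choices distinct.\<close>

lemma card_times_le_of_dominating:
  assumes "finite R" "disjoint Ss" "\<And>u S. u \<in> U \<Longrightarrow> S \<in> Ss \<Longrightarrow> \<exists>s\<in>S. (u, s) \<in> R"
  shows "card U * card Ss \<le> card R"
proof -
  obtain f where f: "\<And>u S. u \<in> U \<Longrightarrow> S \<in> Ss \<Longrightarrow> f u S \<in> S \<and> (u, f u S) \<in> R"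
    using assms(3) by metis
  have "S = S'" if "u \<in> U" "S \<in> Ss" "S' \<in> Ss" "f u S = f u S'" for u S S'
    using disjointD[OF assms(2) that(2,3)] f[OF that(1,2)] f[OF that(1,3)] that(4) by auto
  then have "inj_on (\<lambda>(u, S). (u, f u S)) (U \<times> Ss)"
    by (auto simp: inj_on_def)
  then have "card (U \<times> Ss) \<le> card R"
    by (rule card_inj_on_le) (use f assms(1) in auto)
  then show ?thesis by (simp add: card_cartesian_product)
qed

text \<open>
  The forest edges \<open>F\<close> live on the two classes \<open>A0 \<union> B0\<close> and \<open>A1 \<union> B1\<close>, whose larger sides are
  \<open>B0\<close> and \<open>A1\<close>.  Hence the forest contains at most one dominating set for each of these two sides,
  and every further dominating block costs a query outside of the forest.
\<close>

locale dominating_blocks =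
  fixes R F :: "('a \<times> 'a) set" and A0 A1 B0 B1 :: "'a set" and Ss Ts :: "'a set set"
  assumes fin: "finite R"
    and R: "R \<subseteq> (A0 \<union> A1) \<times> (B0 \<union> B1)" and F: "F \<subseteq> R"
    and AB: "A0 \<inter> A1 = {}" "B0 \<inter> B1 = {}" "A1 \<noteq> {}" "B0 \<noteq> {}"
      "finite A0" "finite A1" "finite B0" "finite B1"
    and sides: "card A0 \<le> card B0" "card B1 \<le> card A1"
    and F0: "card (F \<inter> A0 \<times> B0) + 1 \<le> card A0 + card B0"
    and F1: "card (F \<inter> A1 \<times> B1) + 1 \<le> card A1 + card B1"
    and F01: "F \<inter> A0 \<times> B1 = {}" "F \<inter> A1 \<times> B0 = {}"
    and Ss: "disjoint Ss" "\<And>S. S \<in> Ss \<Longrightarrow> S \<subseteq> B0 \<union> B1"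
    and Ts: "disjoint Ts" "\<And>T. T \<in> Ts \<Longrightarrow> T \<subseteq> A0 \<union> A1"
    and Ss_dom: "\<And>S u. card Ss \<ge> 2 \<Longrightarrow> S \<in> Ss \<Longrightarrow> u \<in> A0 \<union> A1 \<Longrightarrow> \<exists>s\<in>S. (u, s) \<in> R"
    and Ts_dom: "\<And>T w. card Ts \<ge> 2 \<Longrightarrow> T \<in> Ts \<Longrightarrow> w \<in> B0 \<union> B1 \<Longrightarrow> \<exists>t\<in>T. (t, w) \<in> R"
begin

text \<open>Let \<open>k = card Ss\<close> be at least 2. Each vertex of \<open>A1\<close> has a
  pair into each block of \<open>Ss\<close>, and the forest supplies at most
  \<open>2 * card A1 - 1\<close> of these pairs because \<open>B1\<close> is the smaller side. The
  surplus of at least \<open>card A1 * (k - 2) + 1\<close> suffices unless \<open>A1\<close> is a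
  singleton and \<open>Ts\<close> has at least three blocks.\<close>

lemma card_blocks_le_aux:
  assumes le: "card Ts \<le> card Ss"
  shows "card Ss + card Ts \<le> card (R - F) + 3"
proof (cases "card Ss \<ge> 2")
  case True
  let ?k = "card Ss" and ?l = "card Ts"
  let ?R1 = "R \<inter> A1 \<times> (B0 \<union> B1)"
  have finF: "finite F" using F fin finite_subset by blast
  have "card A1 * ?k \<le> card ?R1"
    using Ss_dom[OF True] Ss by (intro card_times_le_of_dominating) (use fin in \<open>auto, blast\<close>)
  moreover have "card ?R1 - card (F \<inter> A1 \<times> B1) \<le> card (?R1 - F \<inter> A1 \<times> B1)"
    using finF by (intro diff_card_le_card_Diff) auto
  moreover have R1: "?R1 - F \<inter> A1 \<times> B1 \<subseteq> (R - F) \<inter> A1 \<times> (B0 \<union> B1)" using F01 by auto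
  then have "card (?R1 - F \<inter> A1 \<times> B1) \<le> card ((R - F) \<inter> A1 \<times> (B0 \<union> B1))"
    using fin by (intro card_mono) auto
  ultimately have x1: "card A1 * ?k + 1 \<le> card ((R - F) \<inter> A1 \<times> (B0 \<union> B1)) + 2 * card A1"
    using F1 sides by linarith
  have x1': "card ((R - F) \<inter> A1 \<times> (B0 \<union> B1)) \<le> card (R - F)"
    using fin by (intro card_mono) auto
  obtain k' where k': "?k = k' + 2" using True by (metis le_add_diff_inverse2)
  have A1: "card A1 \<ge> 1" using AB by (simp add: Suc_leI card_gt_0_iff)
  show ?thesis
  proof (cases "card A1 \<ge> 2")
    case True
    \<comment> \<open>Now the surplus is at least \<open>2 * k' + 1\<close>, that is
      \<open>2 * card Ss - 3\<close>, and \<open>Ts\<close> has no more blocks than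
      \<open>Ss\<close>.\<close>
    then have "2 * k' \<le> card A1 * k'" by (rule mult_le_mono1)
    moreover have "card A1 * ?k = card A1 * k' + 2 * card A1" by (simp add: k')
    ultimately show ?thesis using x1 x1' k' le by linarith
  next
    case False
    then have "card A1 = 1" using A1 by simp
    then obtain u where u: "A1 = {u}" by (rule card_1_singletonE)
    show ?thesis
    proof (cases "?l \<ge> 3")
      case True
      \<comment> \<open>At most one block of \<open>Ts\<close> contains \<open>u\<close>; the others
        lie in \<open>A0\<close> and dominate \<open>B0\<close>. As \<open>A0\<close> is the smaller
        side, the forest pays for fewer than two of them. The resulting surplus in
        \<open>A0 \<times> B0\<close> is disjoint from the one at \<open>A1\<close>.\<close>
      let ?Ts = "{T \<in> Ts. u \<notin> T}" and ?R0 = "R \<inter> A0 \<times> B0"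
      have finTs: "finite Ts" using True by (metis card.infinite not_numeral_le_zero)
      have "T = T'" if "T \<in> Ts" "T' \<in> Ts" "u \<in> T" "u \<in> T'" for T T'
        using disjointD[OF Ts(1) that(1,2)] that by blast
      then have "card {T \<in> Ts. u \<in> T} \<le> Suc 0"
        using finTs by (subst card_le_Suc0_iff_eq) auto
      moreover have "Ts = ?Ts \<union> {T \<in> Ts. u \<in> T}" by auto
      then have "card Ts \<le> card ?Ts + card {T \<in> Ts. u \<in> T}" by (metis card_Un_le)
      ultimately have l: "?l \<le> card ?Ts + 1" by simp
      have "card B0 * card ?Ts \<le> card (?R0\<inverse>)"
      proof (rule card_times_le_of_dominating)
        show "finite (?R0\<inverse>)" using fin by simp
        show "disjoint ?Ts" using Ts(1) by (auto simp: disjoint_def)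
        show "\<exists>t\<in>T. (w, t) \<in> ?R0\<inverse>" if "w \<in> B0" "T \<in> ?Ts" for w T
        proof -
          have "T \<subseteq> A0" using that Ts(2)[of T] u by auto
          then show ?thesis using that Ts_dom[of T w] True by auto
        qed
      qed
      then have "card B0 * card ?Ts \<le> card ?R0" by simp
      moreover have "card ?R0 - card (F \<inter> A0 \<times> B0) \<le> card (?R0 - F \<inter> A0 \<times> B0)"
        using finF by (intro diff_card_le_card_Diff) auto
      moreover have "?R0 - F \<inter> A0 \<times> B0 = (R - F) \<inter> A0 \<times> B0" by auto
      ultimately have "card B0 * card ?Ts + 1 \<le> card ((R - F) \<inter> A0 \<times> B0) + 2 * card B0"
        using F0 sides by simp
      moreover obtain l' where l': "card ?Ts = l' + 2"
        using l True that[of "card ?Ts - 2"] by simp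
      moreover have "1 * l' \<le> card B0 * l'"
        using AB by (intro mult_le_mono1) (simp add: Suc_leI card_gt_0_iff)
      moreover have "card B0 * card ?Ts = card B0 * l' + 2 * card B0" by (simp add: l')
      ultimately have "l' + 1 \<le> card ((R - F) \<inter> A0 \<times> B0)" by linarith
      moreover have "card ((R - F) \<inter> A0 \<times> B0) + card ((R - F) \<inter> A1 \<times> (B0 \<union> B1)) \<le> card (R - F)"
        using fin AB(1)
        by (subst card_Un_disjoint[symmetric]) (auto intro!: card_mono)
      ultimately show ?thesis using x1 u l l' k' by simp
    next
      case False
      \<comment> \<open>For a singleton \<open>A1\<close>, \<open>x1\<close> gives a surplus of at
        least \<open>card Ss - 1\<close>, enough when \<open>Ts\<close> has at most two
        blocks.\<close>
      then show ?thesis using x1 x1' u by simp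
    qed
  qed
qed (use le in auto)

text \<open>Colours and vertex classes are exchanged together, which keeps the larger sides in their
  positions.\<close>

lemma swap: "dominating_blocks (R\<inverse>) (F\<inverse>) B1 B0 A1 A0 Ts Ss"
proof
  have [simp]: "card (F\<inverse> \<inter> B \<times> A) = card (F \<inter> A \<times> B)" for A B
  proof -
    have "F\<inverse> \<inter> B \<times> A = (F \<inter> A \<times> B)\<inverse>" by auto
    then show ?thesis by simp
  qed
  show "card (F\<inverse> \<inter> B1 \<times> A1) + 1 \<le> card B1 + card A1"
    "card (F\<inverse> \<inter> B0 \<times> A0) + 1 \<le> card B0 + card A0"
    using F0 F1 by simp_all
  show "\<exists>s\<in>T. (w, s) \<in> R\<inverse>" if "card Ts \<ge> 2" "T \<in> Ts" "w \<in> B1 \<union> B0" for T w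
    using Ts_dom[of T w] that by auto
  show "\<exists>t\<in>S. (t, u) \<in> R\<inverse>" if "card Ss \<ge> 2" "S \<in> Ss" "u \<in> A1 \<union> A0" for S u
    using Ss_dom[of S u] that by auto
  show "T \<subseteq> B1 \<union> B0" if "T \<in> Ss" for T using Ss(2)[OF that] by auto
  show "T \<subseteq> A1 \<union> A0" if "T \<in> Ts" for T using Ts(2)[OF that] by auto
qed (use fin R F AB sides F01 Ss(1) Ts(1) in auto)

lemma card_blocks_le: "card Ss + card Ts \<le> card (R - F) + 3"
proof (cases "card Ts \<le> card Ss")
  case True
  then show ?thesis by (rule card_blocks_le_aux)
next
  case False
  have "R\<inverse> - F\<inverse> = (R - F)\<inverse>" by auto
  then show ?thesis
    using dominating_blocks.card_blocks_le_aux[OF swap] False by simp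
qed

end

section \<open>Counting queries once the colouring is fixed\<close>

text \<open>Otherwise \<open>S\<close> could be moved to \<open>u\<close>: monochromatic queries do
  not leave their blocks, and the second block \<open>T\<close> provides a leaf that stays at
  \<open>b\<close>.\<close>

lemma (in coloured_hubs) block_dominates:
  assumes fin: "finite V"
    and g: "\<And>q d. (q, d) \<in> set g \<Longrightarrow> q \<in> queries V \<and> answer V (double_star V a b \<sigma>) q = d"
    and known: "diameter_pair_known V g"
    and P: "partition_on {v \<in> V. \<sigma> v} P"
      "\<And>q. q \<in> fst ` set g \<Longrightarrow> q \<subseteq> {v \<in> V. \<sigma> v} \<Longrightarrow> \<exists>S\<in>P. q \<subseteq> S"
    and S: "S \<in> P" "b \<notin> S" and T: "T \<in> P" "b \<notin> T" "T \<noteq> S"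
    and u: "u \<in> V" "\<not> \<sigma> u" "u \<noteq> a"
  shows "\<exists>s\<in>S. {u, s} \<in> fst ` set g"
proof (rule ccontr)
  assume no: "\<not> (\<exists>s\<in>S. {u, s} \<in> fst ` set g)"
  have sub: "S \<subseteq> {v \<in> V. \<sigma> v}" "T \<subseteq> {v \<in> V. \<sigma> v}"
    using partition_onD1[OF P(1)] S T by auto
  have disj: "B = S" if "B \<in> P" "s \<in> B" "s \<in> S" for B s
    using disjointD[OF partition_onD2[OF P(1)] that(1) S(1)] that by auto
  obtain w where w: "w \<in> T" using partition_onD3[OF P(1)] T(1) by (metis ex_in_conv)
  have "\<not> diameter_pair_known V g"
  proof (rule diameter_pair_unknown_if_movable[OF fin])
    show "S \<noteq> {}" using partition_onD3[OF P(1)] S by auto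
    show "w \<notin> S" using disj[of T w] w T by auto
    show "({s, t}, d) \<notin> set g" if st: "s \<in> S" "\<sigma> t" "t \<notin> S" for s t d
    proof
      assume in_g: "({s, t}, d) \<in> set g"
      then have "{s, t} \<subseteq> V" using g[OF in_g] by (auto simp: queries_def doubleton_eq_iff)
      moreover have "{s, t} \<in> fst ` set g" using in_g by force
      ultimately obtain B where "B \<in> P" "{s, t} \<subseteq> B" using P(2)[of "{s, t}"] st sub by auto
      then show False using disj[of B s] st by auto
    qed
    show "({s, u}, d) \<notin> set g" if "s \<in> S" for s d
      using no that by (force simp: insert_commute)
  qed (use sub S T w u g in auto)
  then show False using known by contradiction
qed

text \<open>
  Two vertex classes are left, and the orientation is chosen such that their majority colours differ.
  Every query is either monochromatic, or a forest edge, or counted by the dominating blocks.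
\<close>

lemma (in coloured_hubs) query_bound:
  assumes fin: "finite V"
    and C: "V = C0 \<union> C1" "C0 \<inter> C1 = {}" "a \<in> C0" "b \<in> C0" "c \<in> C0" "\<sigma> c" "c \<noteq> b" "C1 \<noteq> {}"
    and g: "\<And>q d. (q, d) \<in> set g \<Longrightarrow> q \<in> queries V \<and> answer V (double_star V a b \<sigma>) q = d"
    and known: "diameter_pair_known V g"
    and F: "F \<subseteq> fst ` set g" "\<And>p q. {p, q} \<in> F \<Longrightarrow> \<sigma> p \<noteq> \<sigma> q"
      "\<And>e. e \<in> F \<Longrightarrow> e \<subseteq> C0 \<or> e \<subseteq> C1"
      "card {e \<in> F. e \<subseteq> C0} + 3 = card C0" "card {e \<in> F. e \<subseteq> C1} + 1 = card C1"
    and sides: "card {v \<in> C0. \<not> \<sigma> v} \<le> card {v \<in> C0. \<sigma> v}"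
      "card {v \<in> C1. \<sigma> v} \<le> card {v \<in> C1. \<not> \<sigma> v}"
  shows "2 * card V \<le> length g + 9"
proof -
  interpret swapped: coloured_hubs V b a "\<lambda>v. \<not> \<sigma> v" using a b by unfold_locales auto
  define Q where "Q = fst ` set g"
  define X Y where "X = {v \<in> V. \<not> \<sigma> v}" and "Y = {v \<in> V. \<sigma> v}"
  define QX QY QD where "QX = {e \<in> Q. e \<subseteq> X}" and "QY = {e \<in> Q. e \<subseteq> Y}"
    and "QD = {e \<in> Q. \<not> e \<subseteq> X \<and> \<not> e \<subseteq> Y}"
  have Q: "\<exists>p q. e = {p, q} \<and> p \<in> V \<and> q \<in> V \<and> p \<noteq> q" if "e \<in> Q" for e
    using that g by (fastforce simp: Q_def queries_def)
  have finQ: "finite Q" by (simp add: Q_def)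
  have finE: "finite QX" "finite QY" "finite QD" using finQ by (simp_all add: QX_def QY_def QD_def)
  have XY: "V = X \<union> Y" "X \<inter> Y = {}" "finite X" "finite Y"
    using fin by (auto simp: X_def Y_def)
  obtain PX where PX: "partition_on X PX" "\<forall>e\<in>QX. \<exists>S\<in>PX. e \<subseteq> S" "card X \<le> card QX + card PX"
    using ex_closed_partition[OF finE(1) XY(3)] Q by (fastforce simp: QX_def)
  obtain PY where PY: "partition_on Y PY" "\<forall>e\<in>QY. \<exists>S\<in>PY. e \<subseteq> S" "card Y \<le> card QY + card PY"
    using ex_closed_partition[OF finE(2) XY(4)] Q by (fastforce simp: QY_def)
  \<comment> \<open>Only leaves can be moved, so the blocks of the centres are set aside, at a cost
    of at most one block per colour.\<close>
  define Ss Ts where "Ss = {S \<in> PY. b \<notin> S}" and "Ts = {T \<in> PX. a \<notin> T}"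
  have one_less: "card P \<le> card {S \<in> P. z \<notin> S} + 1" if P: "partition_on Z P" and "finite Z" for P Z z
  proof -
    have finP: "finite P" using finite_elements[OF \<open>finite Z\<close> P] .
    have "S = T" if "S \<in> P" "T \<in> P" "z \<in> S" "z \<in> T" for S T
      using disjointD[OF partition_onD2[OF P] that(1,2)] that by blast
    then have "card {S \<in> P. z \<in> S} \<le> Suc 0" using finP by (subst card_le_Suc0_iff_eq) auto
    moreover have "P = {S \<in> P. z \<notin> S} \<union> {S \<in> P. z \<in> S}" by auto
    then have "card P \<le> card {S \<in> P. z \<notin> S} + card {S \<in> P. z \<in> S}" by (metis card_Un_le)
    ultimately show ?thesis by simp
  qed
  define A0 A1 B0 B1 where "A0 = {v \<in> C0. \<not> \<sigma> v} - {a}" and "A1 = {v \<in> C1. \<not> \<sigma> v}"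
    and "B0 = {v \<in> C0. \<sigma> v} - {b}" and "B1 = {v \<in> C1. \<sigma> v}"
  have finC: "finite C0" "finite C1" using fin C by auto
  have nota: "a \<notin> C1" "b \<notin> C1" using C by auto
  have cards: "card {v \<in> C0. \<not> \<sigma> v} = Suc (card A0)" "card {v \<in> C0. \<sigma> v} = Suc (card B0)"
    using a b C finC card.remove[of "{v \<in> C0. \<not> \<sigma> v}" a] card.remove[of "{v \<in> C0. \<sigma> v}" b]
    by (auto simp: A0_def B0_def)
  have split: "card Z = card {v \<in> Z. \<not> \<sigma> v} + card {v \<in> Z. \<sigma> v}" if "finite Z" for Z
    using that by (subst card_Un_disjoint[symmetric]) (auto intro!: arg_cong[of _ _ card])
  have card_C: "card C0 = card A0 + card B0 + 2" "card C1 = card A1 + card B1"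
    using split[OF finC(1)] split[OF finC(2)] cards by (auto simp: A1_def B1_def)
  \<comment> \<open>Ordering the endpoints by colour makes the passage from pairs to queries
    injective.\<close>
  define R where "R = {(u, w). u \<in> A0 \<union> A1 \<and> w \<in> B0 \<union> B1 \<and> {u, w} \<in> Q}"
  define F' where "F' = {(u, w) \<in> R. {u, w} \<in> F}"
  have R_col: "\<not> \<sigma> u" "\<sigma> w" if "(u, w) \<in> R" for u w
    using that by (auto simp: R_def A0_def A1_def B0_def B1_def)
  have inj: "inj_on (\<lambda>(u, w). {u, w}) Z" if "Z \<subseteq> R" for Z
    using that R_col by (fastforce simp: inj_on_def doubleton_eq_iff)
  have finR: "finite R"
    by (rule finite_subset[of _ "(A0 \<union> A1) \<times> (B0 \<union> B1)"])
      (use finC in \<open>auto simp: R_def A0_def A1_def B0_def B1_def\<close>)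
  have finF: "finite F" using F(1) by (rule finite_subset) simp
  have forest: "card (F' \<inter> A \<times> B) \<le> card {e \<in> F. e \<subseteq> Z}" if "A \<subseteq> Z" "B \<subseteq> Z" for A B Z
    by (rule card_inj_on_le[OF inj]) (use that finF in \<open>auto simp: F'_def\<close>)
  have cross: "F' \<inter> A0 \<times> B1 = {}" "F' \<inter> A1 \<times> B0 = {}"
    using F(3) C(2) by (fastforce simp: F'_def A0_def A1_def B0_def B1_def)+
  have AB: "A0 \<union> A1 = X - {a}" "B0 \<union> B1 = Y - {b}"
    using C nota by (auto simp: A0_def A1_def B0_def B1_def X_def Y_def)
  have another: "\<exists>T\<in>P. T \<noteq> S" if "card P \<ge> 2" for S and P :: "'a set set"
  proof (rule ccontr)
    assume "\<not> (\<exists>T\<in>P. T \<noteq> S)"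
    then have "P \<subseteq> {S}" by auto
    then have "card P \<le> card {S}" by (intro card_mono) auto
    then show False using that by simp
  qed
  have g': "q \<in> queries V \<and> answer V (double_star V b a (\<lambda>v. \<not> \<sigma> v)) q = d" if "(q, d) \<in> set g" for q d
    using g[OF that] by (simp add: double_star_swap)
  interpret blocks: dominating_blocks R F' A0 A1 B0 B1 Ss Ts
  proof
    show "finite R" "F' \<inter> A0 \<times> B1 = {}" "F' \<inter> A1 \<times> B0 = {}" by fact+
    show "R \<subseteq> (A0 \<union> A1) \<times> (B0 \<union> B1)" "F' \<subseteq> R" by (auto simp: R_def F'_def)
    show "A0 \<inter> A1 = {}" "B0 \<inter> B1 = {}" using C by (auto simp: A0_def A1_def B0_def B1_def)
    show "finite A0" "finite A1" "finite B0" "finite B1"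
      using finC by (auto simp: A0_def A1_def B0_def B1_def)
    show "B0 \<noteq> {}" using C by (auto simp: B0_def)
    show "card A0 \<le> card B0" using sides(1) cards by simp
    show sides1: "card B1 \<le> card A1" using sides(2) by (simp add: A1_def B1_def)
    have "card C1 > 0" using finC C by (simp add: card_gt_0_iff)
    then show "A1 \<noteq> {}" using card_C sides1 by auto
    \<comment> \<open>\<open>C0\<close> has three vertices more than forest edges; two of them are
      the centres, which leaves the bound for a tree.\<close>
    have "card (F' \<inter> A0 \<times> B0) \<le> card {e \<in> F. e \<subseteq> C0}"
      by (rule forest) (auto simp: A0_def B0_def)
    then show "card (F' \<inter> A0 \<times> B0) + 1 \<le> card A0 + card B0" using F(4) card_C by simp
    have "card (F' \<inter> A1 \<times> B1) \<le> card {e \<in> F. e \<subseteq> C1}"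
      by (rule forest) (auto simp: A1_def B1_def)
    then show "card (F' \<inter> A1 \<times> B1) + 1 \<le> card A1 + card B1" using F(5) card_C by simp
    show "disjoint Ss" "disjoint Ts"
      using partition_onD2[OF PX(1)] partition_onD2[OF PY(1)]
      by (auto simp: Ss_def Ts_def disjoint_def)
    show "S \<subseteq> B0 \<union> B1" if "S \<in> Ss" for S
      using that partition_onD1[OF PY(1)] unfolding AB by (auto simp: Ss_def)
    show "T \<subseteq> A0 \<union> A1" if "T \<in> Ts" for T
      using that partition_onD1[OF PX(1)] unfolding AB by (auto simp: Ts_def)
    show "\<exists>s\<in>S. (u, s) \<in> R" if S: "card Ss \<ge> 2" "S \<in> Ss" "u \<in> A0 \<union> A1" for S u
    proof -
      obtain T where T: "T \<in> Ss" "T \<noteq> S" using another[OF S(1)] by blast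
      have "\<exists>s\<in>S. {u, s} \<in> fst ` set g"
        by (rule block_dominates[OF fin g known, where P = PY and T = T])
          (use PY S T AB in \<open>auto simp: Y_def X_def QY_def Q_def Ss_def\<close>)
      then obtain s where "s \<in> S" "{u, s} \<in> Q" by (auto simp: Q_def)
      moreover have "s \<in> B0 \<union> B1"
        using \<open>s \<in> S\<close> S partition_onD1[OF PY(1)] unfolding AB by (auto simp: Ss_def)
      ultimately show ?thesis using S(3) by (auto simp: R_def)
    qed
    show "\<exists>t\<in>T. (t, w) \<in> R" if T: "card Ts \<ge> 2" "T \<in> Ts" "w \<in> B0 \<union> B1" for T w
    proof -
      obtain S where S: "S \<in> Ts" "S \<noteq> T" using another[OF T(1)] by blast
      have "\<exists>t\<in>T. {w, t} \<in> fst ` set g"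
        by (rule swapped.block_dominates[OF fin g' known, where P = PX and T = S])
          (use PX S T AB in \<open>auto simp: Y_def X_def QX_def Q_def Ts_def\<close>)
      then obtain t where "t \<in> T" "{t, w} \<in> Q" by (auto simp: Q_def insert_commute)
      moreover have "t \<in> A0 \<union> A1"
        using \<open>t \<in> T\<close> T partition_onD1[OF PX(1)] unfolding AB by (auto simp: Ts_def)
      ultimately show ?thesis using T(3) by (auto simp: R_def)
    qed
  qed
  have "{u, w} \<in> QD" if "(u, w) \<in> R" for u w
    using that R_col[OF that] by (auto simp: R_def QD_def X_def Y_def)
  then have "card (R - F') \<le> card (QD - F)"
    by (intro card_inj_on_le[OF inj]) (use finE in \<open>auto simp: F'_def\<close>)
  moreover have F_QD: "F \<subseteq> QD"
  proof
    fix e assume e: "e \<in> F"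
    then have "e \<in> Q" using F(1) by (auto simp: Q_def)
    then obtain p q where "e = {p, q}" using Q by blast
    then show "e \<in> QD" using \<open>e \<in> Q\<close> F(2)[of p q] e by (auto simp: QD_def X_def Y_def)
  qed
  then have "card QD = card F + card (QD - F)"
    using finE(3) finF by (metis card_Diff_subset card_mono le_add_diff_inverse)
  moreover have "card F = card {e \<in> F. e \<subseteq> C0} + card {e \<in> F. e \<subseteq> C1}"
  proof -
    have "e \<noteq> {}" if "e \<in> F" for e using that F_QD Q[of e] by (auto simp: QD_def)
    then have "{e \<in> F. e \<subseteq> C0} \<inter> {e \<in> F. e \<subseteq> C1} = {}" using C(2) by blast
    moreover have "F = {e \<in> F. e \<subseteq> C0} \<union> {e \<in> F. e \<subseteq> C1}" using F(3) by auto
    ultimately show ?thesis using finF by (metis card_Un_disjoint finite_Un)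
  qed
  moreover have "card Q = card QX + card QY + card QD"
  proof -
    have "e \<noteq> {}" if "e \<in> Q" for e using Q[OF that] by auto
    then have "QX \<inter> QY = {}" using XY(2) by (auto simp: QX_def QY_def)
    moreover have "(QX \<union> QY) \<inter> QD = {}" "Q = QX \<union> QY \<union> QD" by (auto simp: QX_def QY_def QD_def)
    ultimately show ?thesis using finE by (simp add: card_Un_disjoint)
  qed
  moreover have "card Q \<le> length g"
    unfolding Q_def by (metis card_length length_map list.set_map)
  moreover have "card V = card X + card Y" using XY card_Un_disjoint by metis
  moreover have "card V = card C0 + card C1" using C finC card_Un_disjoint by metis
  moreover have "card PX \<le> card Ts + 1" "card PY \<le> card Ss + 1"
    unfolding Ts_def Ss_def using one_less[OF PX(1) XY(3)] one_less[OF PY(1) XY(4)] by auto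
  \<comment> \<open>The forest has \<open>card V - 4\<close> edges. The 9 consists of these 4, the 2
    blocks containing centres and the 3 from \<open>card_blocks_le\<close>.\<close>
  ultimately show ?thesis using blocks.card_blocks_le PX(3) PY(3) F(4,5) by linarith
qed

section \<open>The adversary\<close>

text \<open>
  The adversary answers according to a double star whose colouring is only fixed up to recolouring
  the classes in \<open>P\<close> that do not contain the centres; \<open>F\<close> collects the queries that merged two classes.
  The vertices \<open>a\<close>, \<open>b\<close>, \<open>c\<close> share a class from the start, whence the 3.
\<close>

locale adversary_state =
  fixes V :: "'a set" and a b c :: 'a and A :: "'a algorithm"
    and h :: "'a history" and P :: "'a set set" and \<sigma> :: "'a \<Rightarrow> bool" and F :: "'a set set"
  assumes finite_V: "finite V" and algorithm: "algorithm_on V A" and history: "history_of A h"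
    and answers: "(q, d) \<in> set h \<Longrightarrow> answer V (double_star V a b \<sigma>) q = d"
    and partition: "partition_on V P"
    and inside: "q \<in> fst ` set h \<Longrightarrow> \<exists>C\<in>P. q \<subseteq> C"
    and centre: "\<exists>C\<in>P. a \<in> C \<and> b \<in> C \<and> c \<in> C"
    and colours: "\<not> \<sigma> a" "\<sigma> b" "\<sigma> c" "c \<noteq> b"
    and forest: "F \<subseteq> fst ` set h" "{x, y} \<in> F \<Longrightarrow> \<sigma> x \<noteq> \<sigma> y"
    and card_forest: "C \<in> P \<Longrightarrow> card {e \<in> F. e \<subseteq> C} + (if a \<in> C then 3 else 1) = card C"
begin

lemma centre_in: "a \<in> V" "b \<in> V" "c \<in> V"
  using centre partition_onD1[OF partition] by auto

sublocale coloured_hubs V a b \<sigma>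
  using centre_in colours by unfold_locales auto

lemma finite_P: "finite P"
  using finite_elements[OF finite_V partition] .

lemma class_unique: "C \<in> P \<Longrightarrow> D \<in> P \<Longrightarrow> v \<in> C \<Longrightarrow> v \<in> D \<Longrightarrow> C = D"
  using disjointD[OF partition_onD2[OF partition], of C D] by blast

lemma history_queries:
  assumes "q \<in> fst ` set h"
  shows "q \<in> queries V"
proof -
  obtain i where "i < length h" "q = fst (h ! i)" using assms by (auto simp: in_set_conv_nth)
  then show ?thesis using history algorithm by (auto simp: history_of_def algorithm_on_def)
qed

text \<open>Every query lies inside a class, so flipping whole classes preserves whether its
  endpoints agree in colour, and distances depend on nothing else. The class of the centres must
  keep its colours.\<close>

lemma recolour:
  assumes "\<And>C. C \<in> P \<Longrightarrow> (\<forall>v\<in>C. \<tau> v = \<sigma> v) \<or> a \<notin> C \<and> (\<forall>v\<in>C. \<tau> v = (\<not> \<sigma> v))"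
  shows "adversary_state V a b c A h P \<tau> F"
proof -
  have centre_colours: "\<tau> a = \<sigma> a" "\<tau> b = \<sigma> b" "\<tau> c = \<sigma> c" using assms centre by blast+
  then interpret recoloured: coloured_hubs V a b \<tau>
    using centre_in colours by unfold_locales auto
  have rel: "\<tau> x = \<tau> y \<longleftrightarrow> \<sigma> x = \<sigma> y" if "{x, y} \<in> fst ` set h" for x y
    using inside[OF that] assms by (metis insert_subset)
  show ?thesis
  proof
    show "answer V (double_star V a b \<tau>) q = d" if qd: "(q, d) \<in> set h" for q d
    proof -
      have q: "q \<in> fst ` set h" using qd by force
      then obtain x y where xy: "q = {x, y}" "x \<in> V" "y \<in> V" "x \<noteq> y"
        using history_queries[OF q] by (auto simp: queries_def)
      have "graph_dist V (double_star V a b \<tau>) x y = graph_dist V (double_star V a b \<sigma>) x y"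
        unfolding recoloured.graph_dist_double_star[OF xy(2-4)] graph_dist_double_star[OF xy(2-4)]
        using rel q xy(1) by simp
      then show ?thesis using answers[OF qd] by (simp add: xy answer_eq)
    qed
    show "\<tau> p \<noteq> \<tau> q" if "{p, q} \<in> F" for p q
      using that forest rel by (metis subsetD)
  qed (use finite_V algorithm history partition inside centre colours centre_colours forest(1)
      card_forest in auto)
qed

lemma history_snoc:
  assumes "A h = Some q"
  shows "history_of A (h @ [(q, d)])"
  using assms history by (auto simp: history_of_def nth_append less_Suc_eq)

lemma answer_inside:
  assumes "A h = Some q" "C \<in> P" "q \<subseteq> C"
  shows "adversary_state V a b c A (h @ [(q, answer V (double_star V a b \<sigma>) q)]) P \<sigma> F"
proof
  show "history_of A (h @ [(q, answer V (double_star V a b \<sigma>) q)])"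
    using assms(1) by (rule history_snoc)
  show "\<exists>C\<in>P. q' \<subseteq> C" if "q' \<in> fst ` set (h @ [(q, answer V (double_star V a b \<sigma>) q)])" for q'
    using that inside assms by auto
qed (use finite_V algorithm answers partition centre colours forest card_forest in auto)

text \<open>The new edge makes up for the lost class in the forest count. Since \<open>a\<close> is
  not in \<open>D\<close>, the exceptional 3 can come only from \<open>C\<close>.\<close>

lemma answer_merging:
  assumes q: "A h = Some {p, q}" and C: "C \<in> P" "p \<in> C" and D: "D \<in> P" "q \<in> D" "C \<noteq> D"
    and a: "a \<notin> D" and col: "\<sigma> p \<noteq> \<sigma> q"
  shows "adversary_state V a b c A (h @ [({p, q}, answer V (double_star V a b \<sigma>) {p, q})])
    (insert (C \<union> D) (P - {C, D})) \<sigma> (insert {p, q} F)"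
proof
  let ?h = "h @ [({p, q}, answer V (double_star V a b \<sigma>) {p, q})]"
  let ?P = "insert (C \<union> D) (P - {C, D})"
  show "history_of A ?h" using q by (rule history_snoc)
  show "partition_on V ?P" using partition_on_merge[OF partition C(1) D(1)] .
  show "\<exists>C\<in>?P. e \<subseteq> C" if e: "e \<in> fst ` set ?h" for e
  proof (cases "e = {p, q}")
    case False
    then obtain B where "B \<in> P" "e \<subseteq> B" using e inside by auto
    then show ?thesis by (cases "B \<in> {C, D}") auto
  qed (use C D in auto)
  obtain C0 where "C0 \<in> P" "a \<in> C0" "b \<in> C0" "c \<in> C0" using centre by blast
  then show "\<exists>C\<in>?P. a \<in> C \<and> b \<in> C \<and> c \<in> C" by (cases "C0 \<in> {C, D}") auto
  show "insert {p, q} F \<subseteq> fst ` set ?h" using forest(1) by auto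
  show "\<sigma> x \<noteq> \<sigma> y" if "{x, y} \<in> insert {p, q} F" for x y
    using that forest(2) col by (auto simp: doubleton_eq_iff)
  have F_inside: "e \<noteq> {}" "\<exists>B\<in>P. e \<subseteq> B" if "e \<in> F" for e
    using that forest(1) history_queries[of e] inside[of e] by (auto simp: queries_def)
  have finF: "finite F" using forest(1) by (rule finite_subset) simp
  have pq: "p \<notin> B" if "B \<in> P" "B \<noteq> C" for B using class_unique C that by blast
  have qp: "q \<notin> B" if "B \<in> P" "B \<noteq> D" for B using class_unique D that by blast
  have CD: "C \<inter> D = {}" using class_unique C(1) D(1,3) by blast
  have fin: "finite C" "finite D"
    using finite_subset[OF _ finite_V] partition_onD1[OF partition] C(1) D(1) by auto
  show "card {e \<in> insert {p, q} F. e \<subseteq> B} + (if a \<in> B then 3 else 1) = card B" if B: "B \<in> ?P" for B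
  proof (cases "B = C \<union> D")
    case True
    have "e \<subseteq> C \<or> e \<subseteq> D" if e: "e \<in> F" "e \<subseteq> C \<union> D" for e
    proof -
      obtain B' x where "B' \<in> P" "e \<subseteq> B'" "x \<in> e" using F_inside[OF e(1)] by blast
      then show ?thesis using class_unique[of B' C x] class_unique[of B' D x] C(1) D(1) e by blast
    qed
    then have eq: "{e \<in> insert {p, q} F. e \<subseteq> B} =
        insert {p, q} ({e \<in> F. e \<subseteq> C} \<union> {e \<in> F. e \<subseteq> D})"
      using C(2) D(2) True by auto
    have "{p, q} \<notin> F" using F_inside(2)[of "{p, q}"] pq qp D(3) by blast
    moreover have "{e \<in> F. e \<subseteq> C} \<inter> {e \<in> F. e \<subseteq> D} = {}" using F_inside(1) CD by blast
    ultimately have "card {e \<in> insert {p, q} F. e \<subseteq> B} =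
        Suc (card {e \<in> F. e \<subseteq> C} + card {e \<in> F. e \<subseteq> D})"
      unfolding eq using finF by (simp add: card_Un_disjoint)
    moreover have "card B = card C + card D" using True CD fin by (simp add: card_Un_disjoint)
    ultimately show ?thesis using card_forest[OF C(1)] card_forest[OF D(1)] a True by auto
  next
    case False
    then have B': "B \<in> P" "B \<noteq> C" "B \<noteq> D" using B by auto
    then have "{e \<in> insert {p, q} F. e \<subseteq> B} = {e \<in> F. e \<subseteq> B}" using pq by auto
    then show ?thesis using card_forest[OF B'(1)] by simp
  qed
qed (use finite_V algorithm answers colours in auto)

text \<open>Of two different classes at least one avoids the centres. It is flipped if necessary, so
  that the merging query becomes bichromatic.\<close>

lemma answer_query:
  assumes "A h = Some e" "card P \<ge> 3"
  shows "\<exists>d P' \<tau> F'. adversary_state V a b c A (h @ [(e, d)]) P' \<tau> F' \<and> card P' \<ge> 2"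
proof (cases "\<exists>C\<in>P. e \<subseteq> C")
  case True
  then show ?thesis using answer_inside[OF assms(1)] assms(2) by fastforce
next
  case False
  have "e \<in> queries V" using algorithm assms(1) by (simp add: algorithm_on_def)
  then obtain x y where xy: "e = {x, y}" "x \<in> V" "y \<in> V" by (auto simp: queries_def)
  then obtain C D where CD: "C \<in> P" "x \<in> C" "D \<in> P" "y \<in> D"
    using partition_onD1[OF partition] by auto
  then have "C \<noteq> D" using False xy by auto
  then have "a \<notin> C \<or> a \<notin> D" using class_unique CD by blast
  then obtain p q C D where pq: "e = {p, q}" and CD: "C \<in> P" "p \<in> C" "D \<in> P" "q \<in> D" "C \<noteq> D" "a \<notin> D"
    using CD xy \<open>C \<noteq> D\<close> by (metis insert_commute)
  define \<tau> where "\<tau> v = (if v \<in> D \<and> \<sigma> p = \<sigma> q then \<not> \<sigma> v else \<sigma> v)" for v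
  interpret recoloured: adversary_state V a b c A h P \<tau> F
  proof (rule recolour)
    show "(\<forall>v\<in>B. \<tau> v = \<sigma> v) \<or> a \<notin> B \<and> (\<forall>v\<in>B. \<tau> v = (\<not> \<sigma> v))" if "B \<in> P" for B
      using class_unique[OF that CD(3)] CD(6) by (cases "B = D") (auto simp: \<tau>_def)
  qed
  have "p \<notin> D" using class_unique CD by blast
  then have "\<tau> p \<noteq> \<tau> q" using CD(4) by (auto simp: \<tau>_def)
  then have "adversary_state V a b c A (h @ [({p, q}, answer V (double_star V a b \<tau>) {p, q})])
    (insert (C \<union> D) (P - {C, D})) \<tau> (insert {p, q} F)"
    using assms(1) CD pq by (intro recoloured.answer_merging) auto
  moreover have "card (insert (C \<union> D) (P - {C, D})) \<ge> 2"
    using card_partition_merge[OF partition finite_P CD(1,3,5)] assms(2) by simp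
  ultimately show ?thesis using pq by blast
qed

text \<open>Two classes avoid the centres. Recolour one to contain a leaf \<open>v\<close> of
  \<open>b\<close> and the other to contain a leaf \<open>u\<close> of \<open>a\<close>; no query
  leaves the first class, so its leaves of \<open>b\<close> can be moved to \<open>u\<close>, while
  \<open>c\<close> stays at \<open>b\<close>.\<close>

lemma three_classes:
  assumes "card P \<ge> 3"
  shows "\<exists>E. tree_on V E \<and> (\<forall>(q, d)\<in>set h. answer V E q = d) \<and> \<not> diameter_pair_known V h"
proof -
  obtain C0 where C0: "C0 \<in> P" "a \<in> C0" "b \<in> C0" "c \<in> C0" using centre by blast
  have "card (P - {C0}) \<ge> 2" using assms C0 finite_P by simp
  then obtain Q where "Q \<subseteq> P - {C0}" "card Q = 2" by (rule obtain_subset_with_card_n)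
  then obtain C1 C2 where C12: "C1 \<in> P - {C0}" "C2 \<in> P - {C0}" "C1 \<noteq> C2"
    by (auto simp: card_2_iff)
  obtain v u where v: "v \<in> C1" and u: "u \<in> C2"
    using C12 partition_onD3[OF partition] by (metis DiffD1 ex_in_conv)
  have classes: "C1 \<in> P" "C2 \<in> P" "C1 \<noteq> C0" "C2 \<noteq> C0" using C12 by auto
  have out: "a \<notin> C1" "b \<notin> C1" "c \<notin> C1" "a \<notin> C2" "u \<notin> C1"
    using classes C0 C12(3) u class_unique by blast+
  have sub: "C1 \<subseteq> V" "C2 \<subseteq> V" using partition_onD1[OF partition] classes by auto
  define \<tau> where "\<tau> x = (if x \<in> C1 then \<sigma> x = \<sigma> v else if x \<in> C2 then \<sigma> x \<noteq> \<sigma> u else \<sigma> x)" for x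
  interpret recoloured: adversary_state V a b c A h P \<tau> F
  proof (rule recolour)
    show "(\<forall>x\<in>B. \<tau> x = \<sigma> x) \<or> a \<notin> B \<and> (\<forall>x\<in>B. \<tau> x = (\<not> \<sigma> x))" if B: "B \<in> P" for B
    proof -
      consider "B = C1" | "B = C2" | "B \<inter> C1 = {}" "B \<inter> C2 = {}"
        using class_unique[OF B] classes by blast
      then show ?thesis
      proof cases
        case 2
        then have "\<tau> x = (\<sigma> x \<noteq> \<sigma> u)" if "x \<in> B" for x
          using that class_unique[of C1 C2 x] classes C12(3) by (auto simp: \<tau>_def)
        then show ?thesis using 2 out by (cases "\<sigma> u") auto
      qed (use out in \<open>auto simp: \<tau>_def\<close>)
    qed
  qed
  have "\<not> diameter_pair_known V h"
  proof (rule recoloured.diameter_pair_unknown_if_movable[OF finite_V])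
    show "{x \<in> C1. \<tau> x} \<noteq> {}" using v by (auto simp: \<tau>_def)
    show "\<not> \<tau> u" using u out by (simp add: \<tau>_def)
    show "q \<in> queries V \<and> answer V (double_star V a b \<tau>) q = d" if "(q, d) \<in> set h" for q d
      using history_queries[of q] recoloured.answers that by force
    have apart: "({s, t}, d) \<notin> set h" if "s \<in> C1" "t \<notin> C1" for s t d
    proof
      assume "({s, t}, d) \<in> set h"
      then have "{s, t} \<in> fst ` set h" by force
      then obtain B where "B \<in> P" "{s, t} \<subseteq> B" using inside by blast
      then show False using class_unique[of B C1 s] classes that by auto
    qed
    show "({s, t}, d) \<notin> set h" if "s \<in> {x \<in> C1. \<tau> x}" "\<tau> t" "t \<notin> {x \<in> C1. \<tau> x}" for s t d
      using apart that by blast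
    show "({s, u}, d) \<notin> set h" if "s \<in> {x \<in> C1. \<tau> x}" for s d
      using apart that out by blast
  qed (use sub out u centre_in recoloured.colours in auto)
  then show ?thesis
    using recoloured.tree_on_double_star recoloured.answers by blast
qed

text \<open>From here on the tree is fixed and answers are truthful, hence the claim covers all
  continuations \<open>g\<close>. Flipping \<open>C1\<close> makes the majorities differ, and
  exchanging the centres gives them the orientation that \<open>query_bound\<close> expects.\<close>

lemma two_classes:
  assumes "card P = 2"
  shows "\<exists>E. tree_on V E \<and> (\<forall>(q, d)\<in>set h. answer V E q = d) \<and>
    (\<forall>g. set h \<subseteq> set g \<longrightarrow> (\<forall>(q, d)\<in>set g. q \<in> queries V \<and> answer V E q = d) \<longrightarrow>
       diameter_pair_known V g \<longrightarrow> 2 * card V \<le> length g + 9)"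
proof -
  obtain C0 where C0: "C0 \<in> P" "a \<in> C0" "b \<in> C0" "c \<in> C0" using centre by blast
  then have "card (P - {C0}) = 1" using assms finite_P by simp
  then obtain C1 where "P - {C0} = {C1}" by (rule card_1_singletonE)
  then have P: "P = {C0, C1}" "C1 \<noteq> C0" using C0 by auto
  have disj: "C0 \<inter> C1 = {}" using class_unique[of C0 C1] P by auto
  have V: "V = C0 \<union> C1" using partition_onD1[OF partition] P by simp
  have "C1 \<noteq> {}" using partition_onD3[OF partition] P by auto
  define maj where "maj \<tau> C \<longleftrightarrow> card {v \<in> C. \<not> \<tau> v} \<le> card {v \<in> C. \<tau> v}"
    for \<tau> :: "'a \<Rightarrow> bool" and C :: "'a set"
  define flip where "flip \<longleftrightarrow> (maj \<sigma> C0 \<longleftrightarrow> maj \<sigma> C1)"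
  define \<tau> where "\<tau> v = (if v \<in> C1 \<and> flip then \<not> \<sigma> v else \<sigma> v)" for v
  interpret recoloured: adversary_state V a b c A h P \<tau> F
    by (rule recolour) (use P disj C0 in \<open>auto simp: \<tau>_def\<close>)
  have col0: "{v \<in> C0. \<tau> v} = {v \<in> C0. \<sigma> v}" "{v \<in> C0. \<not> \<tau> v} = {v \<in> C0. \<not> \<sigma> v}"
    using disj by (auto simp: \<tau>_def)
  have col1: "{v \<in> C1. \<tau> v} = (if flip then {v \<in> C1. \<not> \<sigma> v} else {v \<in> C1. \<sigma> v})"
    "{v \<in> C1. \<not> \<tau> v} = (if flip then {v \<in> C1. \<sigma> v} else {v \<in> C1. \<not> \<sigma> v})"
    by (auto simp: \<tau>_def)
  have sides: "card {v \<in> C0. \<not> \<tau> v} \<le> card {v \<in> C0. \<tau> v} \<and> card {v \<in> C1. \<tau> v} \<le> card {v \<in> C1. \<not> \<tau> v}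
    \<or> card {v \<in> C0. \<tau> v} < card {v \<in> C0. \<not> \<tau> v} \<and> card {v \<in> C1. \<not> \<tau> v} \<le> card {v \<in> C1. \<tau> v}"
    unfolding col0 col1 flip_def maj_def by auto
  have F: "e \<subseteq> C0 \<or> e \<subseteq> C1" if "e \<in> F" for e using that forest(1) inside[of e] P by auto
  have "a \<notin> C1" using C0 disj by auto
  have card_F: "card {e \<in> F. e \<subseteq> C0} + 3 = card C0" "card {e \<in> F. e \<subseteq> C1} + 1 = card C1"
    using card_forest[of C0] card_forest[of C1] P C0 \<open>a \<notin> C1\<close> by auto
  have "2 * card V \<le> length g + 9"
    if g: "set h \<subseteq> set g" "\<forall>(q, d)\<in>set g. q \<in> queries V \<and> answer V (double_star V a b \<tau>) q = d"
      "diameter_pair_known V g" for g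
  proof -
    have Fg: "F \<subseteq> fst ` set g" using forest(1) g(1) by auto
    show ?thesis
      using sides
    proof
      assume s: "card {v \<in> C0. \<not> \<tau> v} \<le> card {v \<in> C0. \<tau> v} \<and> card {v \<in> C1. \<tau> v} \<le> card {v \<in> C1. \<not> \<tau> v}"
      show ?thesis
        by (rule recoloured.query_bound[OF finite_V V disj C0(2-4) recoloured.colours(3,4)
              \<open>C1 \<noteq> {}\<close> _ g(3) Fg recoloured.forest(2) F card_F])
          (use s g(2) in auto)
    next
      assume s: "card {v \<in> C0. \<tau> v} < card {v \<in> C0. \<not> \<tau> v} \<and> card {v \<in> C1. \<not> \<tau> v} \<le> card {v \<in> C1. \<tau> v}"
      interpret swapped: coloured_hubs V b a "\<lambda>v. \<not> \<tau> v"
        using recoloured.colours centre_in by unfold_locales auto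
      \<comment> \<open>After the exchange a new third vertex is needed. As \<open>b\<close> has the
        strict minority colour in \<open>C0\<close>, the majority colour of \<open>a\<close> occurs
        at least twice there.\<close>
      have "card {b} \<le> card {v \<in> C0. \<tau> v}"
        using C0 V finite_V recoloured.colours by (intro card_mono) auto
      then have "card {v \<in> C0. \<not> \<tau> v} > 1" using s by simp
      then obtain c' where c': "c' \<in> C0" "\<not> \<tau> c'" "c' \<noteq> a"
        using card_mono[of "{a}" "{v \<in> C0. \<not> \<tau> v}"] by fastforce
      have swap: "double_star V b a (\<lambda>v. \<not> \<tau> v) = double_star V a b \<tau>"
        by (rule recoloured.double_star_swap)
      show ?thesis
        by (rule swapped.query_bound[OF finite_V V disj C0(3,2) c' \<open>C1 \<noteq> {}\<close> _ g(3) Fg _ F card_F])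
          (use s g(2) recoloured.forest(2) in \<open>auto simp: swap\<close>)
    qed
  qed
  then show ?thesis
    using recoloured.tree_on_double_star recoloured.answers by blast
qed

end

section \<open>From the initial state to the lower bound\<close>

lemma initial_state:
  assumes "finite V" "algorithm_on V A" "a \<in> V" "b \<in> V" "c \<in> V" "a \<noteq> b" "a \<noteq> c" "b \<noteq> c"
  defines "P \<equiv> insert {a, b, c} ((\<lambda>v. {v}) ` (V - {a, b, c}))"
  shows "adversary_state V a b c A [] P (\<lambda>v. v = b \<or> v = c) {}" "card P + 2 = card V"
proof -
  show "adversary_state V a b c A [] P (\<lambda>v. v = b \<or> v = c) {}"
  proof
    show "partition_on V P"
    proof (rule partition_onI)
      show "\<Union> P = V" using assms(3-5) by (auto simp: P_def)
      show "{} \<notin> P" by (auto simp: P_def)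
      show "disjnt p q" if "p \<in> P" "q \<in> P" "p \<noteq> q" for p q
        using that by (auto simp: P_def disjnt_def)
    qed
    show "card {e \<in> {}. e \<subseteq> C} + (if a \<in> C then 3 else 1) = card C" if "C \<in> P" for C
      using that assms(6-8) by (auto simp: P_def)
    show "\<exists>C\<in>P. a \<in> C \<and> b \<in> C \<and> c \<in> C" by (simp add: P_def)
  qed (use assms(1,2,6-8) in \<open>simp_all add: history_of_def\<close>)
  have "{a, b, c} \<notin> (\<lambda>v. {v}) ` (V - {a, b, c})" using assms(6) by auto
  moreover have three: "card {a, b, c} = 3" using assms(6-8) by simp
  moreover have "card ((\<lambda>v. {v}) ` (V - {a, b, c})) = card V - 3"
    using assms(3-5) three by (simp add: card_image card_Diff_subset)
  moreover have "card {a, b, c} \<le> card V" using assms(1,3-5) by (intro card_mono) auto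
  ultimately show "card P + 2 = card V" using assms(1) by (simp add: P_def)
qed

text \<open>Merging stops at two classes, where the colouring is to be fixed; otherwise play ends
  because the queries are exhausted or the algorithm halts.\<close>

lemma adversary_survives:
  assumes "adversary_state V a b c A [] P \<sigma> F" "card P \<ge> 2"
  shows "\<exists>h P \<sigma> F. adversary_state V a b c A h P \<sigma> F \<and> card P \<ge> 2 \<and> length h \<le> k \<and>
    (card P = 2 \<or> length h = k \<or> A h = None)"
proof (induction k)
  case 0
  then show ?case using assms by force
next
  case (Suc k)
  then obtain h P \<sigma> F where st: "adversary_state V a b c A h P \<sigma> F" "card P \<ge> 2" "length h \<le> k"
    "card P = 2 \<or> length h = k \<or> A h = None"
    by blast
  show ?case
  proof (cases "card P = 2 \<or> A h = None")
    case True
    then show ?thesis using st by (meson le_SucI)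
  next
    case False
    then obtain e where e: "A h = Some e" by blast
    have "card P \<ge> 3" "length h = k" using False st by auto
    then obtain d P' \<tau> F' where "adversary_state V a b c A (h @ [(e, d)]) P' \<tau> F'" "card P' \<ge> 2"
      using adversary_state.answer_query[OF st(1) e] by blast
    then show ?thesis using \<open>length h = k\<close> by (intro exI[of _ "h @ [(e, d)]"]) auto
  qed
qed

lemma adaptively_solvable_bound:
  assumes "finite V" "card V \<ge> 4" "adaptively_solvable V k"
  shows "2 * card V \<le> k + 9"
proof -
  obtain A where A: "algorithm_on V A" and
    known: "\<And>E. tree_on V E \<Longrightarrow> diameter_pair_known V (run V A E k)"
    using assms(3) by (auto simp: adaptively_solvable_def)
  have "3 \<le> card V" using assms(2) by simp
  then obtain B where "B \<subseteq> V" "card B = 3" by (rule obtain_subset_with_card_n)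
  then obtain a b c where abc: "a \<in> V" "b \<in> V" "c \<in> V" "a \<noteq> b" "a \<noteq> c" "b \<noteq> c"
    by (auto simp: card_3_iff)
  obtain h P \<sigma> F where st: "adversary_state V a b c A h P \<sigma> F" "card P \<ge> 2" "length h \<le> k"
    and stop: "card P = 2 \<or> length h = k \<or> A h = None"
    using adversary_survives[OF initial_state(1)[OF assms(1) A abc], of k]
      initial_state(2)[OF assms(1) A abc] assms(2) by fastforce
  interpret adversary_state V a b c A h P \<sigma> F by fact
  have run_h: "run V A E (length h) = h" if "\<forall>(q, d)\<in>set h. answer V E q = d" for E
    using that by (intro run_eq_history[OF history]) auto
  show ?thesis
  proof (cases "card P = 2")
    case True
    obtain E where E: "tree_on V E" "\<forall>(q, d)\<in>set h. answer V E q = d"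
      "\<And>g. set h \<subseteq> set g \<Longrightarrow> \<forall>(q, d)\<in>set g. q \<in> queries V \<and> answer V E q = d \<Longrightarrow>
         diameter_pair_known V g \<Longrightarrow> 2 * card V \<le> length g + 9"
      using two_classes[OF True] by blast
    \<comment> \<open>The history is the beginning of the run on the tree fixed at this
      moment.\<close>
    have "set h \<subseteq> set (run V A E k)"
      using run_extends[OF st(3), of V A E] run_h[OF E(2)] by auto
    then have "2 * card V \<le> length (run V A E k) + 9"
      using run_entries[OF A, of _ _ E k] known[OF E(1)] by (intro E(3)) auto
    then show ?thesis using length_run[of V A E k] by linarith
  next
    case False
    then obtain E where E: "tree_on V E" "\<forall>(q, d)\<in>set h. answer V E q = d"
      "\<not> diameter_pair_known V h"
      using three_classes st(2) by force
    \<comment> \<open>With at least three classes left, the history is already the complete run, yet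
      it determines no diametral pair.\<close>
    have "run V A E k = h"
      using stop False run_h[OF E(2)] run_stopped[OF st(3), of A V E] by auto
    then show ?thesis using known[OF E(1)] E(3) by simp
  qed
qed

theorem theorem1p1:
  fixes V :: "'a set" and n :: nat
  assumes "finite V" and "card V = n" and "n > 0"
  shows "int (f_A V) \<ge> 2 * int n - 9"
\<comment> \<open>Four vertices ensure that the initial \<open>n - 2\<close> classes number at least
  two; for smaller \<open>n\<close> the bound is negative.\<close>
proof (cases "n \<ge> 4")
  case True
  have "adaptively_solvable V (f_A V)"
    unfolding f_A_def using adaptively_solvable_ex[OF assms(1)] by (rule LeastI_ex)
  then have "2 * card V \<le> f_A V + 9"
    using adaptively_solvable_bound assms True by blast
  then show ?thesis using assms by simp
qed simp

end
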